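(* Let $(X,d)$ be a nonempty complete metric space and let $T : X \to X$ be an annular pointwise contractive (APC) mapping, i.e. there exists $c \in [0,1)$ such that for all $x,y \in X$, $$\frac{1}{1+c}\, d(x,Tx) \leq d(x,y) \leq \frac{1}{1-c}\, d(x,Tx) \quad \text{implies} \quad d(Tx,Ty) \leq c\, d(x,y).$$ Then $T$ has a fixed point, i.e. there exists $x^* \in X$ with $Tx^* = x^*$.
   Context: Let $(X,d)$ be a metric space. A mapping $T : X \to X$ is called annular pointwise contractive (APC) if there exists $c \in [0,1)$ such that, for all $x,y \in X$, $\frac{1}{1+c} d(x,Tx) \leq d(x,y) \leq \frac{1}{1-c} d(x,Tx)$ implies $d(Tx,Ty) \leq c\, d(x,y)$. The same constant $c$ appears in the premise and in the conclusion. Continuity of $T$ is not assumed. *)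

theory Defs
  imports "HOL-Analysis.Analysis"
begin

definition annular_pointwise_contractive ::
  "'a set \<Rightarrow> ('a \<Rightarrow> 'a \<Rightarrow> real) \<Rightarrow> ('a \<Rightarrow> 'a) \<Rightarrow> bool" where
  "annular_pointwise_contractive X d T \<longleftrightarrow>
     (\<exists>c. 0 \<le> c \<and> c < 1 \<and>
       (\<forall>x\<in>X. \<forall>y\<in>X.
          1 / (1 + c) * d x (T x) \<le> d x y \<and> d x y \<le> 1 / (1 - c) * d x (T x)
          \<longrightarrow> d (T x) (T y) \<le> c * d x y))"

end

theory Submission
  imports Defs
begin

text \<open>
  Taking \<open>y = T x\<close> in the hypothesis shows that the Picard iterates \<open>x\<^sub>n\<close> are Cauchy, and
  telescoping gives \<open>d x\<^sub>n z \<le> d x\<^sub>n x\<^sub>n\<^sub>+\<^sub>1 / (1 - c)\<close> for their limit \<open>z\<close>, so the upper half of the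
  annulus condition holds for every pair \<open>(x\<^sub>n, z)\<close>. The lower half cannot fail at two consecutive
  indices, since then \<open>d x\<^sub>n x\<^sub>n\<^sub>+\<^sub>1 \<le> d x\<^sub>n z + d x\<^sub>n\<^sub>+\<^sub>1 z < d x\<^sub>n x\<^sub>n\<^sub>+\<^sub>1\<close>. Hence
  \<open>d x\<^sub>n\<^sub>+\<^sub>1 (T z) \<le> c * d x\<^sub>n z\<close> for infinitely many \<open>n\<close>, which forces \<open>T z = z\<close>.
\<close>

context Metric_space
begin

text \<open>By \<open>contr\<close>, each step satisfies \<open>(1 - c) * d (x j) (x (Suc j)) \<le>
  d (x j) (x (Suc j)) - d (x (Suc j)) (x (Suc (Suc j)))\<close>, and the right-hand sides
  telescope.\<close>

lemma telescoping_mdist_bound: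
  fixes x :: "nat \<Rightarrow> 'a" and c :: real
  assumes "\<And>n. x n \<in> M" and "c < 1"
    and contr: "\<And>n. d (x (Suc n)) (x (Suc (Suc n))) \<le> c * d (x n) (x (Suc n))"
  shows "d (x n) (x (n + k)) \<le> 1 / (1 - c) * d (x n) (x (Suc n))"
proof -
  \<comment> \<open>The subtracted last step is kept so that the induction closes; it is dropped
    afterwards by nonnegativity.\<close>
  have "(1 - c) * d (x n) (x (n + k)) \<le> d (x n) (x (Suc n)) - d (x (n + k)) (x (Suc (n + k)))"
  proof (induction k)
    case 0
    then show ?case using assms(1) by simp
  next
    case (Suc k)
    have "(1 - c) * d (x n) (x (n + Suc k))
        \<le> (1 - c) * (d (x n) (x (n + k)) + d (x (n + k)) (x (Suc (n + k))))"
      using assms(1,2) triangle by (intro mult_left_mono) auto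
    with Suc contr[of "n + k"] show ?case by (simp add: algebra_simps)
  qed
  then have "(1 - c) * d (x n) (x (n + k)) \<le> d (x n) (x (Suc n))"
    using nonneg[of "x (n + k)" "x (Suc (n + k))"] by linarith
  then show ?thesis using assms(2) by (simp add: field_simps)
qed

text \<open>The telescoping bound is uniform in \<open>k\<close>, and the step length on its
  right-hand side decays geometrically in \<open>n\<close>.\<close>

lemma MCauchy_if_steps_contract:
  fixes x :: "nat \<Rightarrow> 'a" and c :: real
  assumes inM: "\<And>n. x n \<in> M" and c: "0 \<le> c" "c < 1"
    and contr: "\<And>n. d (x (Suc n)) (x (Suc (Suc n))) \<le> c * d (x n) (x (Suc n))"
  shows "MCauchy x"
proof -
  have geometric: "d (x n) (x (Suc n)) \<le> c ^ n * d (x 0) (x (Suc 0))" for n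
  proof (induction n)
    case (Suc n)
    have "c * d (x n) (x (Suc n)) \<le> c * (c ^ n * d (x 0) (x (Suc 0)))"
      using Suc c by (intro mult_left_mono)
    with contr[of n] show ?case by (simp add: mult.assoc)
  qed simp
  have bound: "d (x n) (x (n + k)) \<le> 1 / (1 - c) * (c ^ n * d (x 0) (x (Suc 0)))" for n k
  proof -
    have "1 / (1 - c) * d (x n) (x (Suc n)) \<le> 1 / (1 - c) * (c ^ n * d (x 0) (x (Suc 0)))"
      using geometric c by (intro mult_left_mono) auto
    with telescoping_mdist_bound[where x = x, OF inM c(2) contr, of n k] show ?thesis by linarith
  qed
  have "(\<lambda>n. 1 / (1 - c) * (c ^ n * d (x 0) (x (Suc 0)))) \<longlonglongrightarrow> 1 / (1 - c) * (0 * d (x 0) (x (Suc 0)))"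
    using c by (intro tendsto_intros LIMSEQ_power_zero) auto
  then have small: "(\<lambda>n. 1 / (1 - c) * (c ^ n * d (x 0) (x (Suc 0)))) \<longlonglongrightarrow> 0"
    by simp
  show ?thesis
    unfolding MCauchy_def
  proof (intro conjI allI impI)
    show "range x \<subseteq> M" using inM by auto
    fix e :: real
    assume "e > 0"
    then obtain N where N: "\<And>n. n \<ge> N \<Longrightarrow> 1 / (1 - c) * (c ^ n * d (x 0) (x (Suc 0))) < e"
      using order_tendstoD(2)[OF small] unfolding eventually_sequentially by blast
    have less: "d (x n) (x m) < e" if "N \<le> n" "n \<le> m" for n m
      using bound[of n "m - n"] N[of n] that by simp
    show "\<exists>N. \<forall>n n'. N \<le> n \<longrightarrow> N \<le> n' \<longrightarrow> d (x n) (x n') < e"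
    proof (intro exI allI impI)
      fix n m assume "N \<le> n" "N \<le> m"
      then show "d (x n) (x m) < e"
        using less[of n m] less[of m n] by (cases "n \<le> m") (auto simp: commute)
    qed
  qed
qed

lemma limit_mdist_le:
  fixes x :: "nat \<Rightarrow> 'a"
  assumes "a \<in> M" and lim: "limitin mtopology x z sequentially"
    and bound: "\<And>m. m \<ge> n \<Longrightarrow> d a (x m) \<le> r"
  shows "d a z \<le> r"
proof (rule field_le_epsilon)
  fix e :: real
  assume "e > 0"
  then obtain N where N: "\<And>m. m \<ge> N \<Longrightarrow> x m \<in> M \<and> d (x m) z < e"
    using lim unfolding limit_metric_sequentially by blast
  have "z \<in> M" using lim unfolding limit_metric_sequentially by blast
  \<comment> \<open>The term at \<open>max n N\<close> is late enough both for \<open>bound\<close>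
    and for being within \<open>e\<close> of \<open>z\<close>.\<close>
  with \<open>a \<in> M\<close> N[of "max n N"] bound[of "max n N"] triangle[of a "x (max n N)" z]
  show "d a z \<le> r + e" by simp
qed

text \<open>Here \<open>x\<close>, \<open>y\<close>, \<open>w\<close> stand for three consecutive
  iterates. If both alternatives failed, then
  \<open>(1 + c) * d x y < d x y + d y w \<le> (1 + c) * d x y\<close>; this is where the constant
  \<open>1 / (1 + c)\<close> fits exactly.\<close>

lemma consecutive_annulus_lower_bound:
  assumes M: "x \<in> M" "y \<in> M" "z \<in> M" and "0 \<le> c"
    and contr: "d y w \<le> c * d x y"
  shows "1 / (1 + c) * d x y \<le> d x z \<or> 1 / (1 + c) * d y w \<le> d y z"
proof (rule ccontr)
  assume "\<not> ?thesis"
  with \<open>0 \<le> c\<close> have "(1 + c) * d x z < d x y" "(1 + c) * d y z < d y w"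
    by (auto simp: field_simps)
  moreover have "(1 + c) * d x y \<le> (1 + c) * (d x z + d y z)"
    using triangle[OF M(1) M(3) M(2)] \<open>0 \<le> c\<close> by (intro mult_left_mono) (auto simp: commute)
  ultimately show False using contr by (simp add: algebra_simps)
qed

end

theorem theorem3p1:
  fixes X :: "'a set" and d :: "'a \<Rightarrow> 'a \<Rightarrow> real" and T :: "'a \<Rightarrow> 'a"
  assumes "Metric_space X d"
    and "X \<noteq> {}"
    and "Metric_space.mcomplete X d"
    and "T \<in> X \<rightarrow> X"
    and "annular_pointwise_contractive X d T"
  shows "\<exists>x\<in>X. T x = x"
proof -
  interpret Metric_space X d by fact
  obtain c where c: "0 \<le> c" "c < 1" and apc: "\<And>x y. \<lbrakk>x \<in> X; y \<in> X;
      1 / (1 + c) * d x (T x) \<le> d x y; d x y \<le> 1 / (1 - c) * d x (T x)\<rbrakk>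
      \<Longrightarrow> d (T x) (T y) \<le> c * d x y"
    using assms(5) unfolding annular_pointwise_contractive_def by blast
  obtain x0 where x0: "x0 \<in> X" using assms(2) by blast
  define x where "x n = (T ^^ n) x0" for n
  have T_x: "T (x n) = x (Suc n)" for n by (simp add: x_def)
  have inX: "x n \<in> X" for n
    by (induction n) (use x0 assms(4) in \<open>auto simp: x_def\<close>)
  have contr: "d (x (Suc n)) (x (Suc (Suc n))) \<le> c * d (x n) (x (Suc n))" for n
  proof -
    \<comment> \<open>The pair lies in the annulus because
      \<open>1 / (1 + c) \<le> 1 \<le> 1 / (1 - c)\<close>.\<close>
    have "d (T (x n)) (T (x (Suc n))) \<le> c * d (x n) (x (Suc n))"
      by (rule apc) (use c inX in \<open>auto simp: T_x field_simps\<close>)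
    then show ?thesis by (simp add: T_x)
  qed
  have "MCauchy x" using MCauchy_if_steps_contract[where x = x, OF inX c contr] .
  then obtain z where lim: "limitin mtopology x z sequentially"
    using assms(3) unfolding mcomplete_def by blast
  then have z: "z \<in> X" unfolding limit_metric_sequentially by blast
  have Tz: "T z \<in> X" using assms(4) z by blast
  have upper: "d (x n) z \<le> 1 / (1 - c) * d (x n) (x (Suc n))" for n
  proof (rule limit_mdist_le[where x = x, OF inX lim])
    fix m assume "m \<ge> n"
    then show "d (x n) (x m) \<le> 1 / (1 - c) * d (x n) (x (Suc n))"
      using telescoping_mdist_bound[where x = x, OF inX c(2) contr, of n "m - n"] by simp
  qed
  have frequent: "\<exists>n\<ge>N. d (x (Suc n)) (T z) \<le> c * d (x n) z" for N
  proof -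
    \<comment> \<open>The witness is \<open>N\<close> or \<open>Suc N\<close>.\<close>
    obtain n where "n \<ge> N" and "1 / (1 + c) * d (x n) (x (Suc n)) \<le> d (x n) z"
      using consecutive_annulus_lower_bound[OF inX inX z c(1) contr, of N]
      by (metis le_refl le_Suc_eq)
    then show ?thesis using apc[OF inX z, of n] upper[of n] by (auto simp: T_x)
  qed
  have "d z (T z) \<le> 0"
  proof (rule field_le_epsilon)
    fix e :: real
    assume "e > 0"
    then have "e / 2 > 0" by simp
    then obtain N where N: "\<And>n. n \<ge> N \<Longrightarrow> d (x n) z < e / 2"
      using lim unfolding limit_metric_sequentially by blast
    \<comment> \<open>One such index suffices, since \<open>d z (T z)\<close> does not depend on
      \<open>n\<close>: going through \<open>x (Suc n)\<close> costs less than \<open>e / 2\<close>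
      on each side.\<close>
    obtain n where n: "n \<ge> N" "d (x (Suc n)) (T z) \<le> c * d (x n) z"
      using frequent by blast
    have "c * d (x n) z \<le> d (x n) z"
      using c by (simp add: mult_left_le_one_le)
    then show "d z (T z) \<le> 0 + e"
      using n N[of n] N[of "Suc n"] triangle[OF z inX Tz, of "Suc n"] by (simp add: commute)
  qed
  then have "T z = z" using z Tz nonneg zero by (metis order_antisym)
  with z show ?thesis by blast
qed

end
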